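(* Let $(G,\delta,\varepsilon)$ be a $q$-counital comonad on a category $\mathbb{A}$. (1) The following are equivalent: (a) $(G,\delta,\varepsilon)$ is an $r$-counital comonad; (b) $(U^G,\phi^G,\alpha^G,\beta^G)$ is a regular pairing of functors between $\mathbb{A}$ and $\underline{\mathbb{A}}^G$. (2) The following are equivalent: (a) $(G,\delta,\varepsilon)$ is a weak comonad; (b) $(U^G,\phi^G,\alpha^G,\beta^G)$ is a regular pairing of functors between $\mathbb{A}$ and $\underline{\mathbb{A}}^G$ with $\beta^G$ symmetric.
   Context: A pairing $(L,R,\alpha,\beta)$ of functors $L:\mathbb{X}\to\mathbb{Y}$, $R:\mathbb{Y}\to\mathbb{X}$ consists of maps $\alpha:\mathrm{Mor}_{\mathbb{Y}}(L(X),Y)\to\mathrm{Mor}_{\mathbb{X}}(X,R(Y))$ and $\beta:\mathrm{Mor}_{\mathbb{X}}(X,R(Y))\to\mathrm{Mor}_{\mathbb{Y}}(L(X),Y)$, natural in $X$ and $Y$. Its quasi-unit is $\eta_X=\alpha(I_{L(X)})$ and its quasi-counit is $\varepsilon_Y=\beta(I_{R(Y)})$. The pairing is regular if $\alpha=\alpha\cdot\beta\cdot\alpha$ and $\beta=\beta\cdot\alpha\cdot\beta$. $\beta$ is symmetric if $LR\varepsilon\cdot L\eta R=\varepsilon LR\cdot L\eta R:LR\to LR$. A $q$-counital comonad $(G,\delta,\varepsilon)$ on $\mathbb{A}$ is an endofunctor $G$ with natural transformations $\delta:G\to GG$, $G\delta\cdot\delta=\delta G\cdot\delta$, and $\varepsilon:G\to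 I_{\mathbb{A}}$ (no further condition). $\varepsilon$ is regular if $\varepsilon\cdot G\varepsilon\cdot\delta=\varepsilon$, and symmetric if $G\varepsilon\cdot\delta=\varepsilon G\cdot\delta$; $\delta$ is compatible if $\delta=G\varepsilon G\cdot\delta G\cdot\delta$. The $q$-counital comonad is $r$-counital if $\varepsilon$ is regular and $\delta$ is compatible; it is a weak comonad if it is $r$-counital and $\varepsilon$ is symmetric. A non-counital $G$-comodule is $(B,\upsilon:B\to G(B))$ with $G\upsilon\cdot\upsilon=\delta_B\cdot\upsilon$; it is compatible if $\upsilon=G\varepsilon_B\cdot\delta_B\cdot\upsilon$. Morphisms are $g$ with $\upsilon'\cdot g=G(g)\cdot\upsilon$; their set is $\mathrm{Mor}^G(B,B')$. $\underline{\mathbb{A}}^G$ is the category of compatible $G$-comodules. $\phi^G(A)=(G(A),\delta_A)$, $U^G$ is the forgetful functor, and for $A\in\mathbb{A}$ and a $G$-comodule $(B,\upsilon)$, $$\alpha^G:\mathrm{Mor}_{\mathbb{A}}(U^G(B),A)\to\mathrm{Mor}^G(B,\phi^G(A)),\ f\mapsto G(f)\cdot\upsilon,$$ $$\beta^G:\mathrm{Mor}^G(B,\phi^G(A))\to\mathrm{Mor}_{\mathbb{A}}(U^G(B),A),\ g\mapsto\varepsilon_A\cdot g.$$ Asserting that this is a pairing between $\mathbb{A}$ and $\underline{\mathbb{A}}^G$ includes that $\phi^G$ takes values in $\underline{\mathbb{A}}^G$ (which means that $\delta$ is compatible). *)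

theory Defs
  imports Main
begin

section \<open>Categories, functors, natural transformations\<close>

record ('o, 'm) cat =
  Obj :: "'o set"
  Arr :: "'m set"
  Dom :: "'m \<Rightarrow> 'o"
  Cod :: "'m \<Rightarrow> 'o"
  Id :: "'o \<Rightarrow> 'm"
  Comp :: "'m \<Rightarrow> 'm \<Rightarrow> 'm"  (infixl "\<cdot>\<index>" 70)

definition Mor :: "('o, 'm, 'z) cat_scheme \<Rightarrow> 'o \<Rightarrow> 'o \<Rightarrow> 'm set" where
  "Mor C X Y = {f \<in> Arr C. Dom C f = X \<and> Cod C f = Y}"

locale category =
  fixes C :: "('o, 'm, 'z) cat_scheme" (structure)
  assumes Dom_Obj: "f \<in> Arr C \<Longrightarrow> Dom C f \<in> Obj C"
    and Cod_Obj: "f \<in> Arr C \<Longrightarrow> Cod C f \<in> Obj C"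
    and Id_Mor: "X \<in> Obj C \<Longrightarrow> Id C X \<in> Mor C X X"
    and Comp_Mor: "\<lbrakk>f \<in> Mor C X Y; g \<in> Mor C Y Z\<rbrakk> \<Longrightarrow> g \<cdot> f \<in> Mor C X Z"
    and Comp_Id_right: "f \<in> Mor C X Y \<Longrightarrow> f \<cdot> Id C X = f"
    and Comp_Id_left: "f \<in> Mor C X Y \<Longrightarrow> Id C Y \<cdot> f = f"
    and Comp_assoc:
      "\<lbrakk>f \<in> Mor C W X; g \<in> Mor C X Y; h \<in> Mor C Y Z\<rbrakk> \<Longrightarrow> (h \<cdot> g) \<cdot> f = h \<cdot> (g \<cdot> f)"

record ('o, 'm, 'p, 'n) ftor =
  fobj :: "'o \<Rightarrow> 'p"
  fmap :: "'m \<Rightarrow> 'n"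

locale is_functor = C: category C + D: category D
  for C :: "('o, 'm) cat" and D :: "('p, 'n) cat" and F :: "('o, 'm, 'p, 'n) ftor" +
  assumes fobj_Obj: "X \<in> Obj C \<Longrightarrow> fobj F X \<in> Obj D"
    and fmap_Mor: "f \<in> Mor C X Y \<Longrightarrow> fmap F f \<in> Mor D (fobj F X) (fobj F Y)"
    and fmap_Id: "X \<in> Obj C \<Longrightarrow> fmap F (Id C X) = Id D (fobj F X)"
    and fmap_Comp:
      "\<lbrakk>f \<in> Mor C X Y; g \<in> Mor C Y Z\<rbrakk> \<Longrightarrow> fmap F (g \<cdot>\<^bsub>C\<^esub> f) = fmap F g \<cdot>\<^bsub>D\<^esub> fmap F f"

definition id_ftor :: "('o, 'm, 'o, 'm) ftor" where
  "id_ftor = \<lparr>fobj = (\<lambda>X. X), fmap = (\<lambda>f. f)\<rparr>"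

definition comp_ftor ::
  "('p, 'n, 'q, 'k) ftor \<Rightarrow> ('o, 'm, 'p, 'n) ftor \<Rightarrow> ('o, 'm, 'q, 'k) ftor" where
  "comp_ftor F' F = \<lparr>fobj = (\<lambda>X. fobj F' (fobj F X)), fmap = (\<lambda>f. fmap F' (fmap F f))\<rparr>"

text \<open>
  A natural transformation \<open>\<tau>\<close> is given by its components. In what follows the transformation
  \<open>F \<tau>\<close> has components \<open>fmap F (\<tau> X)\<close>, and \<open>\<tau> F\<close> has components \<open>\<tau> (fobj F X)\<close>; equations between
  natural transformations are stated componentwise.
\<close>

locale nat_trans = F: is_functor C D F + F': is_functor C D F'
  for C :: "('o, 'm) cat" and D :: "('p, 'n) cat"
    and F F' :: "('o, 'm, 'p, 'n) ftor" and \<tau> :: "'o \<Rightarrow> 'n" +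
  assumes component_Mor: "X \<in> Obj C \<Longrightarrow> \<tau> X \<in> Mor D (fobj F X) (fobj F' X)"
    and naturality: "f \<in> Mor C X Y \<Longrightarrow> \<tau> Y \<cdot>\<^bsub>D\<^esub> fmap F f = fmap F' f \<cdot>\<^bsub>D\<^esub> \<tau> X"


section \<open>Pairings of functors\<close>

locale pairing = L: is_functor \<X> \<Y> L + R: is_functor \<Y> \<X> R
  for \<X> :: "('o, 'm) cat" and \<Y> :: "('p, 'n) cat"
    and L :: "('o, 'm, 'p, 'n) ftor" and R :: "('p, 'n, 'o, 'm) ftor"
    and \<alpha> :: "'o \<Rightarrow> 'p \<Rightarrow> 'n \<Rightarrow> 'm" and \<beta> :: "'o \<Rightarrow> 'p \<Rightarrow> 'm \<Rightarrow> 'n" +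
  assumes alpha_Mor:
      "\<lbrakk>X \<in> Obj \<X>; Y \<in> Obj \<Y>; f \<in> Mor \<Y> (fobj L X) Y\<rbrakk> \<Longrightarrow> \<alpha> X Y f \<in> Mor \<X> X (fobj R Y)"
    and beta_Mor:
      "\<lbrakk>X \<in> Obj \<X>; Y \<in> Obj \<Y>; g \<in> Mor \<X> X (fobj R Y)\<rbrakk> \<Longrightarrow> \<beta> X Y g \<in> Mor \<Y> (fobj L X) Y"
    and alpha_natural_left:
      "\<lbrakk>h \<in> Mor \<X> X' X; Y \<in> Obj \<Y>; f \<in> Mor \<Y> (fobj L X) Y\<rbrakk>
        \<Longrightarrow> \<alpha> X' Y (f \<cdot>\<^bsub>\<Y>\<^esub> fmap L h) = \<alpha> X Y f \<cdot>\<^bsub>\<X>\<^esub> h"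
    and alpha_natural_right:
      "\<lbrakk>X \<in> Obj \<X>; k \<in> Mor \<Y> Y Y'; f \<in> Mor \<Y> (fobj L X) Y\<rbrakk>
        \<Longrightarrow> \<alpha> X Y' (k \<cdot>\<^bsub>\<Y>\<^esub> f) = fmap R k \<cdot>\<^bsub>\<X>\<^esub> \<alpha> X Y f"
    and beta_natural_left:
      "\<lbrakk>h \<in> Mor \<X> X' X; Y \<in> Obj \<Y>; g \<in> Mor \<X> X (fobj R Y)\<rbrakk>
        \<Longrightarrow> \<beta> X' Y (g \<cdot>\<^bsub>\<X>\<^esub> h) = \<beta> X Y g \<cdot>\<^bsub>\<Y>\<^esub> fmap L h"
    and beta_natural_right:
      "\<lbrakk>X \<in> Obj \<X>; k \<in> Mor \<Y> Y Y'; g \<in> Mor \<X> X (fobj R Y)\<rbrakk>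
        \<Longrightarrow> \<beta> X Y' (fmap R k \<cdot>\<^bsub>\<X>\<^esub> g) = k \<cdot>\<^bsub>\<Y>\<^esub> \<beta> X Y g"

locale regular_pairing = pairing +
  assumes alpha_regular:
      "\<lbrakk>X \<in> Obj \<X>; Y \<in> Obj \<Y>; f \<in> Mor \<Y> (fobj L X) Y\<rbrakk> \<Longrightarrow> \<alpha> X Y (\<beta> X Y (\<alpha> X Y f)) = \<alpha> X Y f"
    and beta_regular:
      "\<lbrakk>X \<in> Obj \<X>; Y \<in> Obj \<Y>; g \<in> Mor \<X> X (fobj R Y)\<rbrakk> \<Longrightarrow> \<beta> X Y (\<alpha> X Y (\<beta> X Y g)) = \<beta> X Y g"

definition quasi_unit ::
  "('p, 'n) cat \<Rightarrow> ('o, 'm, 'p, 'n) ftor \<Rightarrow> ('o \<Rightarrow> 'p \<Rightarrow> 'n \<Rightarrow> 'm) \<Rightarrow> 'o \<Rightarrow> 'm" where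
  "quasi_unit \<Y> L \<alpha> X = \<alpha> X (fobj L X) (Id \<Y> (fobj L X))"

definition quasi_counit ::
  "('o, 'm) cat \<Rightarrow> ('p, 'n, 'o, 'm) ftor \<Rightarrow> ('o \<Rightarrow> 'p \<Rightarrow> 'm \<Rightarrow> 'n) \<Rightarrow> 'p \<Rightarrow> 'n" where
  "quasi_counit \<X> R \<beta> Y = \<beta> (fobj R Y) Y (Id \<X> (fobj R Y))"

definition symmetric_beta ::
  "('o, 'm) cat \<Rightarrow> ('p, 'n) cat \<Rightarrow> ('o, 'm, 'p, 'n) ftor \<Rightarrow> ('p, 'n, 'o, 'm) ftor
    \<Rightarrow> ('o \<Rightarrow> 'p \<Rightarrow> 'n \<Rightarrow> 'm) \<Rightarrow> ('o \<Rightarrow> 'p \<Rightarrow> 'm \<Rightarrow> 'n) \<Rightarrow> bool" where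
  "symmetric_beta \<X> \<Y> L R \<alpha> \<beta> \<longleftrightarrow>
    (let \<eta> = quasi_unit \<Y> L \<alpha>; \<epsilon> = quasi_counit \<X> R \<beta> in
      \<forall>Y \<in> Obj \<Y>.
        fmap L (fmap R (\<epsilon> Y)) \<cdot>\<^bsub>\<Y>\<^esub> fmap L (\<eta> (fobj R Y)) =
        \<epsilon> (fobj L (fobj R Y)) \<cdot>\<^bsub>\<Y>\<^esub> fmap L (\<eta> (fobj R Y)))"


section \<open>Weakenings of comonads\<close>

locale q_counital_comonad =
  G: is_functor \<A> \<A> G +
  \<delta>: nat_trans \<A> \<A> G "comp_ftor G G" \<delta> +
  \<epsilon>: nat_trans \<A> \<A> G id_ftor \<epsilon>
  for \<A> :: "('o, 'm) cat" and G :: "('o, 'm, 'o, 'm) ftor"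
    and \<delta> :: "'o \<Rightarrow> 'm" and \<epsilon> :: "'o \<Rightarrow> 'm" +
  assumes coassociative:
    "X \<in> Obj \<A> \<Longrightarrow> fmap G (\<delta> X) \<cdot>\<^bsub>\<A>\<^esub> \<delta> X = \<delta> (fobj G X) \<cdot>\<^bsub>\<A>\<^esub> \<delta> X"

definition regular_counit ::
  "('o, 'm) cat \<Rightarrow> ('o, 'm, 'o, 'm) ftor \<Rightarrow> ('o \<Rightarrow> 'm) \<Rightarrow> ('o \<Rightarrow> 'm) \<Rightarrow> bool" where
  "regular_counit \<A> G \<delta> \<epsilon> \<longleftrightarrow>
    (\<forall>X \<in> Obj \<A>. \<epsilon> X \<cdot>\<^bsub>\<A>\<^esub> fmap G (\<epsilon> X) \<cdot>\<^bsub>\<A>\<^esub> \<delta> X = \<epsilon> X)"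

definition symmetric_counit ::
  "('o, 'm) cat \<Rightarrow> ('o, 'm, 'o, 'm) ftor \<Rightarrow> ('o \<Rightarrow> 'm) \<Rightarrow> ('o \<Rightarrow> 'm) \<Rightarrow> bool" where
  "symmetric_counit \<A> G \<delta> \<epsilon> \<longleftrightarrow>
    (\<forall>X \<in> Obj \<A>. fmap G (\<epsilon> X) \<cdot>\<^bsub>\<A>\<^esub> \<delta> X = \<epsilon> (fobj G X) \<cdot>\<^bsub>\<A>\<^esub> \<delta> X)"

definition compatible_comult ::
  "('o, 'm) cat \<Rightarrow> ('o, 'm, 'o, 'm) ftor \<Rightarrow> ('o \<Rightarrow> 'm) \<Rightarrow> ('o \<Rightarrow> 'm) \<Rightarrow> bool" where
  "compatible_comult \<A> G \<delta> \<epsilon> \<longleftrightarrow>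
    (\<forall>X \<in> Obj \<A>. \<delta> X = fmap G (\<epsilon> (fobj G X)) \<cdot>\<^bsub>\<A>\<^esub> \<delta> (fobj G X) \<cdot>\<^bsub>\<A>\<^esub> \<delta> X)"

definition r_counital_comonad ::
  "('o, 'm) cat \<Rightarrow> ('o, 'm, 'o, 'm) ftor \<Rightarrow> ('o \<Rightarrow> 'm) \<Rightarrow> ('o \<Rightarrow> 'm) \<Rightarrow> bool" where
  "r_counital_comonad \<A> G \<delta> \<epsilon> \<longleftrightarrow>
    q_counital_comonad \<A> G \<delta> \<epsilon> \<and> regular_counit \<A> G \<delta> \<epsilon> \<and> compatible_comult \<A> G \<delta> \<epsilon>"

definition weak_comonad ::
  "('o, 'm) cat \<Rightarrow> ('o, 'm, 'o, 'm) ftor \<Rightarrow> ('o \<Rightarrow> 'm) \<Rightarrow> ('o \<Rightarrow> 'm) \<Rightarrow> bool" where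
  "weak_comonad \<A> G \<delta> \<epsilon> \<longleftrightarrow> r_counital_comonad \<A> G \<delta> \<epsilon> \<and> symmetric_counit \<A> G \<delta> \<epsilon>"


section \<open>Compatible comodules\<close>

definition noncounital_comodule ::
  "('o, 'm) cat \<Rightarrow> ('o, 'm, 'o, 'm) ftor \<Rightarrow> ('o \<Rightarrow> 'm) \<Rightarrow> 'o \<times> 'm \<Rightarrow> bool" where
  "noncounital_comodule \<A> G \<delta> = (\<lambda>(B, \<upsilon>).
    B \<in> Obj \<A> \<and> \<upsilon> \<in> Mor \<A> B (fobj G B) \<and> fmap G \<upsilon> \<cdot>\<^bsub>\<A>\<^esub> \<upsilon> = \<delta> B \<cdot>\<^bsub>\<A>\<^esub> \<upsilon>)"

definition compatible_comodule ::
  "('o, 'm) cat \<Rightarrow> ('o, 'm, 'o, 'm) ftor \<Rightarrow> ('o \<Rightarrow> 'm) \<Rightarrow> ('o \<Rightarrow> 'm) \<Rightarrow> 'o \<times> 'm \<Rightarrow> bool" where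
  "compatible_comodule \<A> G \<delta> \<epsilon> = (\<lambda>(B, \<upsilon>).
    noncounital_comodule \<A> G \<delta> (B, \<upsilon>) \<and> \<upsilon> = fmap G (\<epsilon> B) \<cdot>\<^bsub>\<A>\<^esub> \<delta> B \<cdot>\<^bsub>\<A>\<^esub> \<upsilon>)"

definition comodule_Mor ::
  "('o, 'm) cat \<Rightarrow> ('o, 'm, 'o, 'm) ftor \<Rightarrow> 'o \<times> 'm \<Rightarrow> 'o \<times> 'm \<Rightarrow> 'm set" where
  "comodule_Mor \<A> G = (\<lambda>(B, \<upsilon>) (B', \<upsilon>').
    {g \<in> Mor \<A> B B'. \<upsilon>' \<cdot>\<^bsub>\<A>\<^esub> g = fmap G g \<cdot>\<^bsub>\<A>\<^esub> \<upsilon>})"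

text \<open>
  An arrow of the category of compatible comodules is a comodule morphism \<open>g\<close> tagged with its
  source and target, since one \<open>g\<close> can be a morphism for several choices of coactions.
\<close>

type_synonym ('o, 'm) comodule_arr = "('o \<times> 'm) \<times> 'm \<times> ('o \<times> 'm)"

definition comodule_cat ::
  "('o, 'm) cat \<Rightarrow> ('o, 'm, 'o, 'm) ftor \<Rightarrow> ('o \<Rightarrow> 'm) \<Rightarrow> ('o \<Rightarrow> 'm)
    \<Rightarrow> ('o \<times> 'm, ('o, 'm) comodule_arr) cat" where
  "comodule_cat \<A> G \<delta> \<epsilon> = \<lparr>
    Obj = {M. compatible_comodule \<A> G \<delta> \<epsilon> M},
    Arr = {(M, g, N). compatible_comodule \<A> G \<delta> \<epsilon> M \<and> compatible_comodule \<A> G \<delta> \<epsilon> N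
            \<and> g \<in> comodule_Mor \<A> G M N},
    Dom = (\<lambda>(M, g, N). M),
    Cod = (\<lambda>(M, g, N). N),
    Id = (\<lambda>M. (M, Id \<A> (fst M), M)),
    Comp = (\<lambda>(N', h, P) (M, g, N). (M, h \<cdot>\<^bsub>\<A>\<^esub> g, P))\<rparr>"

definition forgetful :: "('o \<times> 'm, ('o, 'm) comodule_arr, 'o, 'm) ftor" where
  "forgetful = \<lparr>fobj = (\<lambda>(B, \<upsilon>). B), fmap = (\<lambda>(M, g, N). g)\<rparr>"

definition free_ftor ::
  "('o, 'm) cat \<Rightarrow> ('o, 'm, 'o, 'm) ftor \<Rightarrow> ('o \<Rightarrow> 'm)
    \<Rightarrow> ('o, 'm, 'o \<times> 'm, ('o, 'm) comodule_arr) ftor" where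
  "free_ftor \<A> G \<delta> = \<lparr>
    fobj = (\<lambda>X. (fobj G X, \<delta> X)),
    fmap = (\<lambda>f. ((fobj G (Dom \<A> f), \<delta> (Dom \<A> f)), fmap G f, (fobj G (Cod \<A> f), \<delta> (Cod \<A> f))))\<rparr>"

definition alpha_comod ::
  "('o, 'm) cat \<Rightarrow> ('o, 'm, 'o, 'm) ftor \<Rightarrow> ('o \<Rightarrow> 'm)
    \<Rightarrow> 'o \<times> 'm \<Rightarrow> 'o \<Rightarrow> 'm \<Rightarrow> ('o, 'm) comodule_arr" where
  "alpha_comod \<A> G \<delta> = (\<lambda>(B, \<upsilon>) X f. ((B, \<upsilon>), fmap G f \<cdot>\<^bsub>\<A>\<^esub> \<upsilon>, (fobj G X, \<delta> X)))"

definition beta_comod ::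
  "('o, 'm) cat \<Rightarrow> ('o \<Rightarrow> 'm) \<Rightarrow> 'o \<times> 'm \<Rightarrow> 'o \<Rightarrow> ('o, 'm) comodule_arr \<Rightarrow> 'm" where
  "beta_comod \<A> \<epsilon> = (\<lambda>M X (_, g, _). \<epsilon> X \<cdot>\<^bsub>\<A>\<^esub> g)"

end

theory Submission
  imports Defs
begin

text \<open>
  Everything reduces to identities in the base category. For a compatible comodule \<open>(B, \<upsilon>)\<close> and
  \<open>f : B \<rightarrow> X\<close>, naturality of \<open>\<epsilon>\<close> and coassociativity of \<open>\<upsilon>\<close> give
  \<open>\<alpha> \<beta> \<alpha> f = G(\<epsilon>\<^sub>X \<cdot> G f \<cdot> \<upsilon>) \<cdot> \<upsilon> = G f \<cdot> (G \<epsilon>\<^sub>B \<cdot> \<delta>\<^sub>B \<cdot> \<upsilon>)\<close>,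
  which is \<open>\<alpha> f\<close> by compatibility of \<open>\<upsilon>\<close>. For a comodule morphism \<open>g : (B, \<upsilon>) \<rightarrow> \<phi>(X)\<close>,
  the morphism condition gives
  \<open>\<beta> \<alpha> \<beta> g = \<epsilon>\<^sub>X \<cdot> G(\<epsilon>\<^sub>X \<cdot> g) \<cdot> \<upsilon> = (\<epsilon>\<^sub>X \<cdot> G \<epsilon>\<^sub>X \<cdot> \<delta>\<^sub>X) \<cdot> g\<close>,
  which is \<open>\<beta> g\<close> if \<open>\<epsilon>\<close> is regular. So the first identity is automatic on compatible comodules.
  The second one, evaluated at the identity of \<open>\<phi>(X)\<close>, is precisely regularity of \<open>\<epsilon>\<close>, and
  \<open>\<phi>\<close> takes values in compatible comodules if and only if \<open>\<delta>\<close> is compatible. This proves the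
  first equivalence.

  The quasi-unit at \<open>\<phi>(X)\<close> has underlying morphism \<open>\<delta>\<^sub>X\<close>, and the quasi-counit at \<open>X\<close> is
  \<open>\<epsilon>\<^sub>X\<close>. So symmetry of \<open>\<beta>\<close> is literally symmetry of \<open>\<epsilon>\<close>, which proves the second one.
\<close>

section \<open>Unfolding the comodule category and its functors\<close>

lemma Mor_Obj:
  assumes "category C" "f \<in> Mor C X Y"
  shows "X \<in> Obj C" "Y \<in> Obj C"
  using assms category.Dom_Obj category.Cod_Obj by (fastforce simp: Mor_def)+

lemma Mor_comodule_cat:
  "a \<in> Mor (comodule_cat \<A> G \<delta> \<epsilon>) M N \<longleftrightarrow>
    (\<exists>g. a = (M, g, N) \<and> compatible_comodule \<A> G \<delta> \<epsilon> M \<and> compatible_comodule \<A> G \<delta> \<epsilon> N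
       \<and> g \<in> comodule_Mor \<A> G M N)"
  by (auto simp: Mor_def comodule_cat_def)

lemma comodule_cat_simps [simp]:
  "M \<in> Obj (comodule_cat \<A> G \<delta> \<epsilon>) \<longleftrightarrow> compatible_comodule \<A> G \<delta> \<epsilon> M"
  "Id (comodule_cat \<A> G \<delta> \<epsilon>) M = (M, Id \<A> (fst M), M)"
  "(N', h, P) \<cdot>\<^bsub>comodule_cat \<A> G \<delta> \<epsilon>\<^esub> (M, g, N) = (M, h \<cdot>\<^bsub>\<A>\<^esub> g, P)"
  by (auto simp: comodule_cat_def)

lemma forgetful_simps [simp]:
  "fobj forgetful (B, \<upsilon>) = B" "fmap forgetful (M, g, N) = g"
  by (auto simp: forgetful_def)

lemma fobj_free_ftor [simp]: "fobj (free_ftor \<A> G \<delta>) X = (fobj G X, \<delta> X)"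
  by (simp add: free_ftor_def)

lemma fmap_free_ftor:
  assumes "f \<in> Mor \<A> X Y"
  shows "fmap (free_ftor \<A> G \<delta>) f = ((fobj G X, \<delta> X), fmap G f, (fobj G Y, \<delta> Y))"
  using assms by (auto simp: free_ftor_def Mor_def)

lemma alpha_comod_simp [simp]:
  "alpha_comod \<A> G \<delta> (B, \<upsilon>) X f = ((B, \<upsilon>), fmap G f \<cdot>\<^bsub>\<A>\<^esub> \<upsilon>, (fobj G X, \<delta> X))"
  by (simp add: alpha_comod_def)

lemma beta_comod_simp [simp]: "beta_comod \<A> \<epsilon> M X (N, g, P) = \<epsilon> X \<cdot>\<^bsub>\<A>\<^esub> g"
  by (simp add: beta_comod_def)

context q_counital_comonad
begin

text \<open>The locale axioms with the composite and identity functors unfolded.\<close>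

lemma delta_Mor: "X \<in> Obj \<A> \<Longrightarrow> \<delta> X \<in> Mor \<A> (fobj G X) (fobj G (fobj G X))"
  using \<delta>.component_Mor[of X] by (simp add: comp_ftor_def)

lemma epsilon_Mor: "X \<in> Obj \<A> \<Longrightarrow> \<epsilon> X \<in> Mor \<A> (fobj G X) X"
  using \<epsilon>.component_Mor[of X] by (simp add: id_ftor_def)

lemma delta_natural:
  "f \<in> Mor \<A> X Y \<Longrightarrow> \<delta> Y \<cdot>\<^bsub>\<A>\<^esub> fmap G f = fmap G (fmap G f) \<cdot>\<^bsub>\<A>\<^esub> \<delta> X"
  using \<delta>.naturality[of f X Y] by (simp add: comp_ftor_def)

lemma epsilon_natural: "f \<in> Mor \<A> X Y \<Longrightarrow> \<epsilon> Y \<cdot>\<^bsub>\<A>\<^esub> fmap G f = f \<cdot>\<^bsub>\<A>\<^esub> \<epsilon> X"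
  using \<epsilon>.naturality[of f X Y] by (simp add: id_ftor_def)

lemma compatible_comoduleD:
  assumes "compatible_comodule \<A> G \<delta> \<epsilon> (B, \<upsilon>)"
  shows "B \<in> Obj \<A>" "\<upsilon> \<in> Mor \<A> B (fobj G B)" "fmap G \<upsilon> \<cdot>\<^bsub>\<A>\<^esub> \<upsilon> = \<delta> B \<cdot>\<^bsub>\<A>\<^esub> \<upsilon>"
    "\<upsilon> = fmap G (\<epsilon> B) \<cdot>\<^bsub>\<A>\<^esub> \<delta> B \<cdot>\<^bsub>\<A>\<^esub> \<upsilon>"
  using assms by (auto simp: compatible_comodule_def noncounital_comodule_def)

lemma comodule_MorD:
  assumes "g \<in> comodule_Mor \<A> G (B, \<upsilon>) (B', \<upsilon>')"
  shows "g \<in> Mor \<A> B B'" "\<upsilon>' \<cdot>\<^bsub>\<A>\<^esub> g = fmap G g \<cdot>\<^bsub>\<A>\<^esub> \<upsilon>"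
  using assms by (auto simp: comodule_Mor_def)

section \<open>The category of compatible comodules\<close>

lemma Id_comodule_Mor:
  assumes "compatible_comodule \<A> G \<delta> \<epsilon> (B, \<upsilon>)"
  shows "Id \<A> B \<in> comodule_Mor \<A> G (B, \<upsilon>) (B, \<upsilon>)"
  using compatible_comoduleD[OF assms]
  by (simp add: comodule_Mor_def G.C.Id_Mor G.fmap_Id G.C.Comp_Id_right G.C.Comp_Id_left)

lemma Comp_comodule_Mor:
  assumes M: "compatible_comodule \<A> G \<delta> \<epsilon> (B, \<upsilon>)" and N: "compatible_comodule \<A> G \<delta> \<epsilon> (B', \<upsilon>')"
    and P: "compatible_comodule \<A> G \<delta> \<epsilon> (B'', \<upsilon>'')"
    and g: "g \<in> comodule_Mor \<A> G (B, \<upsilon>) (B', \<upsilon>')" and h: "h \<in> comodule_Mor \<A> G (B', \<upsilon>') (B'', \<upsilon>'')"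
  shows "h \<cdot>\<^bsub>\<A>\<^esub> g \<in> comodule_Mor \<A> G (B, \<upsilon>) (B'', \<upsilon>'')"
proof -
  note g = comodule_MorD[OF g] and h = comodule_MorD[OF h]
  note \<upsilon> = compatible_comoduleD(2)[OF M] compatible_comoduleD(2)[OF N] compatible_comoduleD(2)[OF P]
  note G = G.fmap_Mor[OF g(1)] G.fmap_Mor[OF h(1)]
  have "\<upsilon>'' \<cdot>\<^bsub>\<A>\<^esub> (h \<cdot>\<^bsub>\<A>\<^esub> g) = (\<upsilon>'' \<cdot>\<^bsub>\<A>\<^esub> h) \<cdot>\<^bsub>\<A>\<^esub> g"
    by (rule G.C.Comp_assoc[OF g(1) h(1) \<upsilon>(3), symmetric])
  also have "\<dots> = fmap G h \<cdot>\<^bsub>\<A>\<^esub> (\<upsilon>' \<cdot>\<^bsub>\<A>\<^esub> g)"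
    by (simp add: h(2) G.C.Comp_assoc[OF g(1) \<upsilon>(2) G(2)])
  also have "\<dots> = fmap G (h \<cdot>\<^bsub>\<A>\<^esub> g) \<cdot>\<^bsub>\<A>\<^esub> \<upsilon>"
    by (simp add: g(2) G.C.Comp_assoc[OF \<upsilon>(1) G] G.fmap_Comp[OF g(1) h(1)])
  finally show ?thesis
    using G.C.Comp_Mor[OF g(1) h(1)] by (simp add: comodule_Mor_def)
qed

lemma category_comodule_cat: "category (comodule_cat \<A> G \<delta> \<epsilon>)"
proof
  fix a
  assume "a \<in> Arr (comodule_cat \<A> G \<delta> \<epsilon>)"
  then show "Dom (comodule_cat \<A> G \<delta> \<epsilon>) a \<in> Obj (comodule_cat \<A> G \<delta> \<epsilon>)"
    and "Cod (comodule_cat \<A> G \<delta> \<epsilon>) a \<in> Obj (comodule_cat \<A> G \<delta> \<epsilon>)"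
    by (auto simp: comodule_cat_def)
next
  fix M assume "M \<in> Obj (comodule_cat \<A> G \<delta> \<epsilon>)"
  then show "Id (comodule_cat \<A> G \<delta> \<epsilon>) M \<in> Mor (comodule_cat \<A> G \<delta> \<epsilon>) M M"
    by (cases M) (simp add: Mor_comodule_cat Id_comodule_Mor)
next
  fix a b M N P
  assume "a \<in> Mor (comodule_cat \<A> G \<delta> \<epsilon>) M N" "b \<in> Mor (comodule_cat \<A> G \<delta> \<epsilon>) N P"
  then show "b \<cdot>\<^bsub>comodule_cat \<A> G \<delta> \<epsilon>\<^esub> a \<in> Mor (comodule_cat \<A> G \<delta> \<epsilon>) M P"
    by (cases M; cases N; cases P) (auto simp: Mor_comodule_cat intro: Comp_comodule_Mor)
next
  fix a M N
  assume "a \<in> Mor (comodule_cat \<A> G \<delta> \<epsilon>) M N"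
  then show "a \<cdot>\<^bsub>comodule_cat \<A> G \<delta> \<epsilon>\<^esub> Id (comodule_cat \<A> G \<delta> \<epsilon>) M = a"
    and "Id (comodule_cat \<A> G \<delta> \<epsilon>) N \<cdot>\<^bsub>comodule_cat \<A> G \<delta> \<epsilon>\<^esub> a = a"
    by (cases M; cases N;
        auto simp: Mor_comodule_cat dest!: comodule_MorD(1) intro: G.C.Comp_Id_right G.C.Comp_Id_left)+
next
  fix a b c M N P Q
  assume "a \<in> Mor (comodule_cat \<A> G \<delta> \<epsilon>) M N" "b \<in> Mor (comodule_cat \<A> G \<delta> \<epsilon>) N P"
    "c \<in> Mor (comodule_cat \<A> G \<delta> \<epsilon>) P Q"
  then show "(c \<cdot>\<^bsub>comodule_cat \<A> G \<delta> \<epsilon>\<^esub> b) \<cdot>\<^bsub>comodule_cat \<A> G \<delta> \<epsilon>\<^esub> a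
      = c \<cdot>\<^bsub>comodule_cat \<A> G \<delta> \<epsilon>\<^esub> (b \<cdot>\<^bsub>comodule_cat \<A> G \<delta> \<epsilon>\<^esub> a)"
    by (cases M; cases N; cases P; cases Q)
      (auto simp: Mor_comodule_cat dest!: comodule_MorD(1) intro: G.C.Comp_assoc)
qed

lemma is_functor_forgetful: "is_functor (comodule_cat \<A> G \<delta> \<epsilon>) \<A> forgetful"
proof -
  interpret K: category "comodule_cat \<A> G \<delta> \<epsilon>"
    by (rule category_comodule_cat)
  show ?thesis
    by unfold_locales
      (auto simp: Mor_comodule_cat dest: compatible_comoduleD(1) comodule_MorD(1))
qed

section \<open>The cofree functor\<close>

text \<open>The comultiplication is compatible exactly when the cofree comodules are.\<close>

lemma compatible_comult_iff_free:
  "compatible_comult \<A> G \<delta> \<epsilon> \<longleftrightarrow>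
    (\<forall>X \<in> Obj \<A>. compatible_comodule \<A> G \<delta> \<epsilon> (fobj G X, \<delta> X))"
  using G.fobj_Obj delta_Mor coassociative
  by (auto simp: compatible_comult_def compatible_comodule_def noncounital_comodule_def)

lemma is_functor_free_ftor:
  assumes "compatible_comult \<A> G \<delta> \<epsilon>"
  shows "is_functor \<A> (comodule_cat \<A> G \<delta> \<epsilon>) (free_ftor \<A> G \<delta>)"
proof -
  interpret K: category "comodule_cat \<A> G \<delta> \<epsilon>"
    by (rule category_comodule_cat)
  have free: "compatible_comodule \<A> G \<delta> \<epsilon> (fobj G X, \<delta> X)" if "X \<in> Obj \<A>" for X
    using assms that compatible_comult_iff_free by blast
  show ?thesis
  proof
    fix X assume "X \<in> Obj \<A>"
    then show "fobj (free_ftor \<A> G \<delta>) X \<in> Obj (comodule_cat \<A> G \<delta> \<epsilon>)"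
      by (simp add: free)
  next
    fix f X Y assume f: "f \<in> Mor \<A> X Y"
    then show "fmap (free_ftor \<A> G \<delta>) f
        \<in> Mor (comodule_cat \<A> G \<delta> \<epsilon>) (fobj (free_ftor \<A> G \<delta>) X) (fobj (free_ftor \<A> G \<delta>) Y)"
      by (simp add: Mor_comodule_cat fmap_free_ftor free Mor_Obj[OF G.C.category_axioms f]
          comodule_Mor_def G.fmap_Mor delta_natural)
  next
    fix X assume "X \<in> Obj \<A>"
    then show "fmap (free_ftor \<A> G \<delta>) (Id \<A> X)
        = Id (comodule_cat \<A> G \<delta> \<epsilon>) (fobj (free_ftor \<A> G \<delta>) X)"
      by (simp add: fmap_free_ftor[OF G.C.Id_Mor] G.fmap_Id)
  next
    fix f g X Y Z assume "f \<in> Mor \<A> X Y" "g \<in> Mor \<A> Y Z"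
    then show "fmap (free_ftor \<A> G \<delta>) (g \<cdot>\<^bsub>\<A>\<^esub> f)
        = fmap (free_ftor \<A> G \<delta>) g \<cdot>\<^bsub>comodule_cat \<A> G \<delta> \<epsilon>\<^esub> fmap (free_ftor \<A> G \<delta>) f"
      by (simp add: fmap_free_ftor[OF G.C.Comp_Mor] fmap_free_ftor G.fmap_Comp)
  qed
qed

section \<open>Regularity of the pairing\<close>

lemma alpha_comodule_Mor:
  assumes M: "compatible_comodule \<A> G \<delta> \<epsilon> (B, \<upsilon>)" and f: "f \<in> Mor \<A> B X"
  shows "fmap G f \<cdot>\<^bsub>\<A>\<^esub> \<upsilon> \<in> comodule_Mor \<A> G (B, \<upsilon>) (fobj G X, \<delta> X)"
proof -
  note \<upsilon> = compatible_comoduleD[OF M]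
  note Gf = G.fmap_Mor[OF f] and Gv = G.fmap_Mor[OF \<upsilon>(2)]
  note X = Mor_Obj(2)[OF G.C.category_axioms f]
  have "\<delta> X \<cdot>\<^bsub>\<A>\<^esub> (fmap G f \<cdot>\<^bsub>\<A>\<^esub> \<upsilon>) = (fmap G (fmap G f) \<cdot>\<^bsub>\<A>\<^esub> \<delta> B) \<cdot>\<^bsub>\<A>\<^esub> \<upsilon>"
    by (simp add: G.C.Comp_assoc[OF \<upsilon>(2) Gf delta_Mor[OF X], symmetric] delta_natural[OF f])
  also have "\<dots> = fmap G (fmap G f) \<cdot>\<^bsub>\<A>\<^esub> (fmap G \<upsilon> \<cdot>\<^bsub>\<A>\<^esub> \<upsilon>)"
    by (simp add: G.C.Comp_assoc[OF \<upsilon>(2) delta_Mor[OF \<upsilon>(1)] G.fmap_Mor[OF Gf]] \<upsilon>(3))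
  also have "\<dots> = fmap G (fmap G f \<cdot>\<^bsub>\<A>\<^esub> \<upsilon>) \<cdot>\<^bsub>\<A>\<^esub> \<upsilon>"
    by (simp add: G.C.Comp_assoc[OF \<upsilon>(2) Gv G.fmap_Mor[OF Gf]] G.fmap_Comp[OF \<upsilon>(2) Gf])
  finally show ?thesis
    using G.C.Comp_Mor[OF \<upsilon>(2) Gf] by (simp add: comodule_Mor_def)
qed

text \<open>
  The underlying identity of \<open>\<alpha> \<beta> \<alpha> = \<alpha>\<close>. It needs no regularity of \<open>\<epsilon>\<close>: the last step is the
  compatibility of the coaction.
\<close>

lemma alpha_regular_base:
  assumes M: "compatible_comodule \<A> G \<delta> \<epsilon> (B, \<upsilon>)" and f: "f \<in> Mor \<A> B X"
  shows "fmap G (\<epsilon> X \<cdot>\<^bsub>\<A>\<^esub> (fmap G f \<cdot>\<^bsub>\<A>\<^esub> \<upsilon>)) \<cdot>\<^bsub>\<A>\<^esub> \<upsilon> = fmap G f \<cdot>\<^bsub>\<A>\<^esub> \<upsilon>"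
proof -
  note \<upsilon> = compatible_comoduleD[OF M]
  note Gf = G.fmap_Mor[OF f] and Gv = G.fmap_Mor[OF \<upsilon>(2)]
  note X = Mor_Obj(2)[OF G.C.category_axioms f]
  note e = epsilon_Mor[OF \<upsilon>(1)]
  note Ge = G.fmap_Mor[OF e]
  have ev: "\<epsilon> B \<cdot>\<^bsub>\<A>\<^esub> \<upsilon> \<in> Mor \<A> B B"
    by (rule G.C.Comp_Mor[OF \<upsilon>(2) e])
  have "\<epsilon> X \<cdot>\<^bsub>\<A>\<^esub> (fmap G f \<cdot>\<^bsub>\<A>\<^esub> \<upsilon>) = f \<cdot>\<^bsub>\<A>\<^esub> (\<epsilon> B \<cdot>\<^bsub>\<A>\<^esub> \<upsilon>)"
    by (simp add: G.C.Comp_assoc[OF \<upsilon>(2) Gf epsilon_Mor[OF X], symmetric] epsilon_natural[OF f]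
        G.C.Comp_assoc[OF \<upsilon>(2) e f])
  then have "fmap G (\<epsilon> X \<cdot>\<^bsub>\<A>\<^esub> (fmap G f \<cdot>\<^bsub>\<A>\<^esub> \<upsilon>)) \<cdot>\<^bsub>\<A>\<^esub> \<upsilon>
      = fmap G f \<cdot>\<^bsub>\<A>\<^esub> (fmap G (\<epsilon> B \<cdot>\<^bsub>\<A>\<^esub> \<upsilon>) \<cdot>\<^bsub>\<A>\<^esub> \<upsilon>)"
    by (simp add: G.fmap_Comp[OF ev f] G.C.Comp_assoc[OF \<upsilon>(2) G.fmap_Mor[OF ev] Gf])
  also have "fmap G (\<epsilon> B \<cdot>\<^bsub>\<A>\<^esub> \<upsilon>) \<cdot>\<^bsub>\<A>\<^esub> \<upsilon> = fmap G (\<epsilon> B) \<cdot>\<^bsub>\<A>\<^esub> (\<delta> B \<cdot>\<^bsub>\<A>\<^esub> \<upsilon>)"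
    by (simp add: G.fmap_Comp[OF \<upsilon>(2) e] G.C.Comp_assoc[OF \<upsilon>(2) Gv Ge] \<upsilon>(3))
  also have "\<dots> = \<upsilon>"
    using \<upsilon>(4) by (simp add: G.C.Comp_assoc[OF \<upsilon>(2) delta_Mor[OF \<upsilon>(1)] Ge])
  finally show ?thesis .
qed

text \<open>
  The left-hand side is \<open>\<beta> \<alpha> \<beta> g\<close>. Since \<open>\<epsilon>\<close> is not assumed regular here, the identity serves both
  directions of the first equivalence.
\<close>

lemma beta_alpha_beta_base:
  assumes M: "compatible_comodule \<A> G \<delta> \<epsilon> (B, \<upsilon>)" and X: "X \<in> Obj \<A>"
    and g: "g \<in> comodule_Mor \<A> G (B, \<upsilon>) (fobj G X, \<delta> X)"
  shows "\<epsilon> X \<cdot>\<^bsub>\<A>\<^esub> (fmap G (\<epsilon> X \<cdot>\<^bsub>\<A>\<^esub> g) \<cdot>\<^bsub>\<A>\<^esub> \<upsilon>)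
    = (\<epsilon> X \<cdot>\<^bsub>\<A>\<^esub> fmap G (\<epsilon> X) \<cdot>\<^bsub>\<A>\<^esub> \<delta> X) \<cdot>\<^bsub>\<A>\<^esub> g"
proof -
  note \<upsilon> = compatible_comoduleD[OF M] and g = comodule_MorD[OF g]
  note e = epsilon_Mor[OF X] and d = delta_Mor[OF X]
  note Ge = G.fmap_Mor[OF e]
  have "fmap G (\<epsilon> X \<cdot>\<^bsub>\<A>\<^esub> g) \<cdot>\<^bsub>\<A>\<^esub> \<upsilon> = fmap G (\<epsilon> X) \<cdot>\<^bsub>\<A>\<^esub> (\<delta> X \<cdot>\<^bsub>\<A>\<^esub> g)"
    by (simp add: G.fmap_Comp[OF g(1) e] G.C.Comp_assoc[OF \<upsilon>(2) G.fmap_Mor[OF g(1)] Ge] g(2))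
  then show ?thesis
    by (simp add: G.C.Comp_assoc[OF g(1) d Ge] G.C.Comp_assoc[OF d Ge e]
        G.C.Comp_assoc[OF g(1) G.C.Comp_Mor[OF d Ge] e])
qed

lemma regular_pairing_comodule:
  assumes reg: "regular_counit \<A> G \<delta> \<epsilon>" and comp: "compatible_comult \<A> G \<delta> \<epsilon>"
  shows "regular_pairing (comodule_cat \<A> G \<delta> \<epsilon>) \<A> forgetful (free_ftor \<A> G \<delta>)
    (alpha_comod \<A> G \<delta>) (beta_comod \<A> \<epsilon>)"
proof -
  interpret U: is_functor "comodule_cat \<A> G \<delta> \<epsilon>" \<A> forgetful
    by (rule is_functor_forgetful)
  interpret F: is_functor \<A> "comodule_cat \<A> G \<delta> \<epsilon>" "free_ftor \<A> G \<delta>"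
    by (rule is_functor_free_ftor[OF comp])
  have free: "compatible_comodule \<A> G \<delta> \<epsilon> (fobj G X, \<delta> X)" if "X \<in> Obj \<A>" for X
    using comp that compatible_comult_iff_free by blast
  show ?thesis
  proof
    fix M X f
    assume M: "M \<in> Obj (comodule_cat \<A> G \<delta> \<epsilon>)" and X: "X \<in> Obj \<A>"
      and f: "f \<in> Mor \<A> (fobj forgetful M) X"
    obtain B \<upsilon> where [simp]: "M = (B, \<upsilon>)" by (cases M)
    show "alpha_comod \<A> G \<delta> M X f \<in> Mor (comodule_cat \<A> G \<delta> \<epsilon>) M (fobj (free_ftor \<A> G \<delta>) X)"
      using M X f by (simp add: Mor_comodule_cat free alpha_comodule_Mor)
    show "alpha_comod \<A> G \<delta> M X (beta_comod \<A> \<epsilon> M X (alpha_comod \<A> G \<delta> M X f))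
        = alpha_comod \<A> G \<delta> M X f"
      using M f by (simp add: alpha_regular_base)
  next
    fix M X a
    assume M: "M \<in> Obj (comodule_cat \<A> G \<delta> \<epsilon>)" and X: "X \<in> Obj \<A>"
      and a: "a \<in> Mor (comodule_cat \<A> G \<delta> \<epsilon>) M (fobj (free_ftor \<A> G \<delta>) X)"
    obtain B \<upsilon> where [simp]: "M = (B, \<upsilon>)" by (cases M)
    from a obtain g where [simp]: "a = (M, g, (fobj G X, \<delta> X))"
      and g: "g \<in> comodule_Mor \<A> G (B, \<upsilon>) (fobj G X, \<delta> X)"
      by (auto simp: Mor_comodule_cat)
    show "beta_comod \<A> \<epsilon> M X a \<in> Mor \<A> (fobj forgetful M) X"
      using G.C.Comp_Mor[OF comodule_MorD(1)[OF g] epsilon_Mor[OF X]] by simp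
    show "beta_comod \<A> \<epsilon> M X (alpha_comod \<A> G \<delta> M X (beta_comod \<A> \<epsilon> M X a))
        = beta_comod \<A> \<epsilon> M X a"
      using M beta_alpha_beta_base[OF _ X g] reg X by (simp add: regular_counit_def)
  next
    fix b M' M X f
    assume b: "b \<in> Mor (comodule_cat \<A> G \<delta> \<epsilon>) M' M" and X: "X \<in> Obj \<A>"
      and f: "f \<in> Mor \<A> (fobj forgetful M) X"
    obtain B \<upsilon> B' \<upsilon>' where [simp]: "M = (B, \<upsilon>)" "M' = (B', \<upsilon>')" by (cases M; cases M')
    from b obtain h where [simp]: "b = (M', h, M)"
      and M': "compatible_comodule \<A> G \<delta> \<epsilon> (B', \<upsilon>')" and M: "compatible_comodule \<A> G \<delta> \<epsilon> (B, \<upsilon>)"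
      and "h \<in> comodule_Mor \<A> G (B', \<upsilon>') (B, \<upsilon>)"
      by (auto simp: Mor_comodule_cat)
    note h = comodule_MorD[OF this(4)]
    from f have f: "f \<in> Mor \<A> B X" by simp
    note Gh = G.fmap_Mor[OF h(1)] and Gf = G.fmap_Mor[OF f]
    have "fmap G (f \<cdot>\<^bsub>\<A>\<^esub> h) \<cdot>\<^bsub>\<A>\<^esub> \<upsilon>' = (fmap G f \<cdot>\<^bsub>\<A>\<^esub> \<upsilon>) \<cdot>\<^bsub>\<A>\<^esub> h"
      by (simp add: G.fmap_Comp[OF h(1) f] h(2)
          G.C.Comp_assoc[OF compatible_comoduleD(2)[OF M'] Gh Gf]
          G.C.Comp_assoc[OF h(1) compatible_comoduleD(2)[OF M] Gf])
    then show "alpha_comod \<A> G \<delta> M' X (f \<cdot>\<^bsub>\<A>\<^esub> fmap forgetful b)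
        = alpha_comod \<A> G \<delta> M X f \<cdot>\<^bsub>comodule_cat \<A> G \<delta> \<epsilon>\<^esub> b"
      by simp
  next
    fix M k X X' f
    assume M: "M \<in> Obj (comodule_cat \<A> G \<delta> \<epsilon>)" and k: "k \<in> Mor \<A> X X'"
      and f: "f \<in> Mor \<A> (fobj forgetful M) X"
    obtain B \<upsilon> where [simp]: "M = (B, \<upsilon>)" by (cases M)
    from f have f: "f \<in> Mor \<A> B X" by simp
    from M have v: "\<upsilon> \<in> Mor \<A> B (fobj G B)"
      by (simp add: compatible_comoduleD(2))
    show "alpha_comod \<A> G \<delta> M X' (k \<cdot>\<^bsub>\<A>\<^esub> f)
        = fmap (free_ftor \<A> G \<delta>) k \<cdot>\<^bsub>comodule_cat \<A> G \<delta> \<epsilon>\<^esub> alpha_comod \<A> G \<delta> M X f"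
      by (simp add: fmap_free_ftor[OF k] G.fmap_Comp[OF f k]
          G.C.Comp_assoc[OF v G.fmap_Mor[OF f] G.fmap_Mor[OF k]])
  next
    fix b M' M X a
    assume b: "b \<in> Mor (comodule_cat \<A> G \<delta> \<epsilon>) M' M" and X: "X \<in> Obj \<A>"
      and a: "a \<in> Mor (comodule_cat \<A> G \<delta> \<epsilon>) M (fobj (free_ftor \<A> G \<delta>) X)"
    obtain B \<upsilon> B' \<upsilon>' where [simp]: "M = (B, \<upsilon>)" "M' = (B', \<upsilon>')" by (cases M; cases M')
    from b obtain h where [simp]: "b = (M', h, M)" and "h \<in> comodule_Mor \<A> G (B', \<upsilon>') (B, \<upsilon>)"
      by (auto simp: Mor_comodule_cat)
    note h = comodule_MorD(1)[OF this(2)]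
    from a obtain g where [simp]: "a = (M, g, (fobj G X, \<delta> X))"
      and "g \<in> comodule_Mor \<A> G (B, \<upsilon>) (fobj G X, \<delta> X)"
      by (auto simp: Mor_comodule_cat)
    note g = comodule_MorD(1)[OF this(2)]
    show "beta_comod \<A> \<epsilon> M' X (a \<cdot>\<^bsub>comodule_cat \<A> G \<delta> \<epsilon>\<^esub> b)
        = beta_comod \<A> \<epsilon> M X a \<cdot>\<^bsub>\<A>\<^esub> fmap forgetful b"
      by (simp add: G.C.Comp_assoc[OF h g epsilon_Mor[OF X]])
  next
    fix M k X X' a
    assume k: "k \<in> Mor \<A> X X'"
      and a: "a \<in> Mor (comodule_cat \<A> G \<delta> \<epsilon>) M (fobj (free_ftor \<A> G \<delta>) X)"
    obtain B \<upsilon> where [simp]: "M = (B, \<upsilon>)" by (cases M)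
    from a obtain g where [simp]: "a = (M, g, (fobj G X, \<delta> X))"
      and "g \<in> comodule_Mor \<A> G (B, \<upsilon>) (fobj G X, \<delta> X)"
      by (auto simp: Mor_comodule_cat)
    note g = comodule_MorD(1)[OF this(2)]
    note X = Mor_Obj[OF G.C.category_axioms k]
    have "\<epsilon> X' \<cdot>\<^bsub>\<A>\<^esub> (fmap G k \<cdot>\<^bsub>\<A>\<^esub> g) = k \<cdot>\<^bsub>\<A>\<^esub> (\<epsilon> X \<cdot>\<^bsub>\<A>\<^esub> g)"
      by (simp add: G.C.Comp_assoc[OF g G.fmap_Mor[OF k] epsilon_Mor[OF X(2)], symmetric]
          epsilon_natural[OF k] G.C.Comp_assoc[OF g epsilon_Mor[OF X(1)] k])
    then show "beta_comod \<A> \<epsilon> M X' (fmap (free_ftor \<A> G \<delta>) k \<cdot>\<^bsub>comodule_cat \<A> G \<delta> \<epsilon>\<^esub> a)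
        = k \<cdot>\<^bsub>\<A>\<^esub> beta_comod \<A> \<epsilon> M X a"
      by (simp add: fmap_free_ftor[OF k])
  qed
qed

lemma r_counital_of_regular_pairing:
  assumes "regular_pairing (comodule_cat \<A> G \<delta> \<epsilon>) \<A> forgetful (free_ftor \<A> G \<delta>)
    (alpha_comod \<A> G \<delta>) (beta_comod \<A> \<epsilon>)"
  shows "regular_counit \<A> G \<delta> \<epsilon>" and "compatible_comult \<A> G \<delta> \<epsilon>"
proof -
  interpret P: regular_pairing "comodule_cat \<A> G \<delta> \<epsilon>" \<A> forgetful "free_ftor \<A> G \<delta>"
    "alpha_comod \<A> G \<delta>" "beta_comod \<A> \<epsilon>"
    by (rule assms)
  have free: "compatible_comodule \<A> G \<delta> \<epsilon> (fobj G X, \<delta> X)" if "X \<in> Obj \<A>" for X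
    using P.R.fobj_Obj[OF that] by simp
  then show "compatible_comult \<A> G \<delta> \<epsilon>"
    by (simp add: compatible_comult_iff_free)
  show "regular_counit \<A> G \<delta> \<epsilon>"
    unfolding regular_counit_def
  proof
    fix X assume X: "X \<in> Obj \<A>"
    let ?M = "(fobj G X, \<delta> X)"
    note M = free[OF X]
    note g = Id_comodule_Mor[OF M]
    note e = epsilon_Mor[OF X]
    note eGed = G.C.Comp_Mor[OF delta_Mor[OF X] G.C.Comp_Mor[OF G.fmap_Mor[OF e] e]]
    \<comment> \<open>evaluate \<open>\<beta> \<alpha> \<beta> = \<beta>\<close> at the identity of the cofree comodule on \<open>X\<close>\<close>
    have "\<epsilon> X \<cdot>\<^bsub>\<A>\<^esub> (fmap G (\<epsilon> X \<cdot>\<^bsub>\<A>\<^esub> Id \<A> (fobj G X)) \<cdot>\<^bsub>\<A>\<^esub> \<delta> X) = \<epsilon> X \<cdot>\<^bsub>\<A>\<^esub> Id \<A> (fobj G X)"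
      using P.beta_regular[of ?M X "(?M, Id \<A> (fobj G X), ?M)"] M X g
      by (simp add: Mor_comodule_cat)
    then show "\<epsilon> X \<cdot>\<^bsub>\<A>\<^esub> fmap G (\<epsilon> X) \<cdot>\<^bsub>\<A>\<^esub> \<delta> X = \<epsilon> X"
      using beta_alpha_beta_base[OF M X g] G.C.Comp_Id_right[OF eGed] G.C.Comp_Id_right[OF e] by simp
  qed
qed

section \<open>Symmetry and the equivalences\<close>

lemma symmetric_beta_iff_symmetric_counit:
  "symmetric_beta (comodule_cat \<A> G \<delta> \<epsilon>) \<A> forgetful (free_ftor \<A> G \<delta>)
      (alpha_comod \<A> G \<delta>) (beta_comod \<A> \<epsilon>) \<longleftrightarrow> symmetric_counit \<A> G \<delta> \<epsilon>"
proof -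
  have eta: "quasi_unit \<A> forgetful (alpha_comod \<A> G \<delta>) (fobj G X, \<delta> X)
      = ((fobj G X, \<delta> X), \<delta> X, (fobj G (fobj G X), \<delta> (fobj G X)))" if "X \<in> Obj \<A>" for X
    using that
    by (simp add: quasi_unit_def G.fmap_Id G.fobj_Obj G.C.Comp_Id_left[OF delta_Mor])
  have eps: "quasi_counit (comodule_cat \<A> G \<delta> \<epsilon>) (free_ftor \<A> G \<delta>) (beta_comod \<A> \<epsilon>) X = \<epsilon> X"
    if "X \<in> Obj \<A>" for X
    using that by (simp add: quasi_counit_def G.C.Comp_Id_right[OF epsilon_Mor])
  show ?thesis
    by (simp add: symmetric_beta_def symmetric_counit_def eta eps G.fobj_Obj
        fmap_free_ftor[OF epsilon_Mor])
qed

end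

theorem proposition4p4:
  fixes \<A> :: "('o, 'm) cat" and G :: "('o, 'm, 'o, 'm) ftor"
    and \<delta> :: "'o \<Rightarrow> 'm" and \<epsilon> :: "'o \<Rightarrow> 'm"
  assumes "q_counital_comonad \<A> G \<delta> \<epsilon>"
  shows "(r_counital_comonad \<A> G \<delta> \<epsilon> \<longleftrightarrow>
           regular_pairing (comodule_cat \<A> G \<delta> \<epsilon>) \<A> forgetful (free_ftor \<A> G \<delta>)
             (alpha_comod \<A> G \<delta>) (beta_comod \<A> \<epsilon>)) \<and>
         (weak_comonad \<A> G \<delta> \<epsilon> \<longleftrightarrow>
           regular_pairing (comodule_cat \<A> G \<delta> \<epsilon>) \<A> forgetful (free_ftor \<A> G \<delta>)
             (alpha_comod \<A> G \<delta>) (beta_comod \<A> \<epsilon>) \<and>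
           symmetric_beta (comodule_cat \<A> G \<delta> \<epsilon>) \<A> forgetful (free_ftor \<A> G \<delta>)
             (alpha_comod \<A> G \<delta>) (beta_comod \<A> \<epsilon>))"
proof -
  interpret q_counital_comonad \<A> G \<delta> \<epsilon>
    by (rule assms)
  have "r_counital_comonad \<A> G \<delta> \<epsilon> \<longleftrightarrow>
      regular_pairing (comodule_cat \<A> G \<delta> \<epsilon>) \<A> forgetful (free_ftor \<A> G \<delta>)
        (alpha_comod \<A> G \<delta>) (beta_comod \<A> \<epsilon>)"
    using assms regular_pairing_comodule r_counital_of_regular_pairing
    by (auto simp: r_counital_comonad_def)
  then show ?thesis
    by (simp add: weak_comonad_def symmetric_beta_iff_symmetric_counit)
qed

end
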